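(* Fix $q\in(0,1)$. There exist constants $c_k$ ($k=1,2,\dots$), with $c_k$ depending only on $k$ (and on the fixed $q$, but not on $n$ or on the measures below), such that the following holds. Let $n\ge 1$ and let $\mathbb{P}$ be a $q$-exchangeable probability measure on $\{0,1\}^n$. Then there exists a probability measure $\mu$ on $\Delta_q$ such that $$\|\mathbb{P}_k-\mathbb{P}_{\mu,k}\|\le c_k\, q^{n}\qquad\text{for all } 1\le k\le n.$$
   Context: $q\in(0,1)$ is fixed. A probability measure $\mathbb{P}$ on $\{0,1\}^n$ is $q$-exchangeable if for every $(\varepsilon_1,\dots,\varepsilon_n)\in\{0,1\}^n$ and every $1\le i\le n-1$, $$\mathbb{P}(\varepsilon_1,\dots,\varepsilon_{i-1},\varepsilon_{i+1},\varepsilon_i,\varepsilon_{i+2},\dots,\varepsilon_n)=q^{\varepsilon_i-\varepsilon_{i+1}}\,\mathbb{P}(\varepsilon_1,\dots,\varepsilon_n).$$ $\Delta_q=\{1,q,q^2,\dots\}\cup\{0\}\subset[0,1]$. For $x\in\Delta_q$ and $m\ge1$, $\nu^q_x$ denotes the unique $q$-exchangeable probability measure on $\{0,1\}^m$ such that for $0\le j\le m$ the sequence $(1,\dots,1,0,\dots,0)$ with $j$ ones followed by $m-j$ zeros has probability $q^{-j(m-j)}x^{m-j}(x;q^{-1})_j$, where $(x;q^{-1})_j=\prod_{i=0}^{j-1}(1-xq^{-i})$, $(x;q^{-1})_0=1$, and $0^0=1$. For a probability measure $\mu$ on $\Delta_q$, $\mathbb{P}_{\mu,m}$ is the probability measure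 on $\{0,1\}^m$ given by $\mathbb{P}_{\mu,m}(A)=\int_{\Delta_q}\nu^q_x(A)\,\mu(dx)$ for $A\subset\{0,1\}^m$. For a measure $\mathbb{P}$ on $\{0,1\}^n$ and $k\le n$, $\mathbb{P}_k$ is the pushforward of $\mathbb{P}$ under the projection $\{0,1\}^n\to\{0,1\}^k$ onto the first $k$ coordinates. The variational distance of probability measures on $\{0,1\}^k$ is $\|\mu-\nu\|=2\sup_{A\subset\{0,1\}^k}|\mu(A)-\nu(A)|$. *)

theory Defs
  imports "HOL-Probability.Probability"
begin

text \<open>
  Points of $\{0,1\}^n$ are boolean lists of length \<open>n\<close>, with \<open>True\<close> standing for 1.
  Probability measures on $\{0,1\}^n$, and on the countable set $\Delta_q$ (whose Borel sets are
  all of its subsets), are given as \<open>pmf\<close>s supported there.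
\<close>

definition words :: "nat \<Rightarrow> bool list set" where
  "words n = {w. length w = n}"

definition swap_adj :: "nat \<Rightarrow> bool list \<Rightarrow> bool list" where
  "swap_adj i w = w[i := w ! Suc i, Suc i := w ! i]"

text \<open>Positions are counted from 0, so \<open>Suc i < n\<close> covers the \<open>n - 1\<close> adjacent pairs.\<close>

definition q_exchangeable :: "real \<Rightarrow> nat \<Rightarrow> bool list pmf \<Rightarrow> bool" where
  "q_exchangeable q n P \<longleftrightarrow>
     set_pmf P \<subseteq> words n \<and>
     (\<forall>w \<in> words n. \<forall>i. Suc i < n \<longrightarrow>
        pmf P (swap_adj i w) =
          q powi (of_bool (w ! i) - of_bool (w ! Suc i)) * pmf P w)"

definition Delta :: "real \<Rightarrow> real set" where
  "Delta q = insert 0 (range (\<lambda>i::nat. q ^ i))"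

definition q_pochhammer :: "real \<Rightarrow> real \<Rightarrow> nat \<Rightarrow> real" where
  "q_pochhammer a r j = (\<Prod>i<j. 1 - a * r ^ i)"

text \<open>Meaningful for \<open>x \<in> Delta q\<close> only: for other \<open>x\<close> the prescribed values may be negative.\<close>

definition nu :: "real \<Rightarrow> nat \<Rightarrow> real \<Rightarrow> bool list pmf" where
  "nu q m x = (THE P. q_exchangeable q m P \<and>
     (\<forall>j\<le>m. pmf P (replicate j True @ replicate (m - j) False) =
        q powi (- int (j * (m - j))) * x ^ (m - j) * q_pochhammer x (inverse q) j))"

definition mixture :: "real \<Rightarrow> real pmf \<Rightarrow> nat \<Rightarrow> bool list pmf" where
  "mixture q \<mu> m = bind_pmf \<mu> (nu q m)"

lemma prob_mixture:
  "measure_pmf.prob (mixture q \<mu> m) A = (\<integral>x. measure_pmf.prob (nu q m x) A \<partial>measure_pmf \<mu>)"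
  unfolding mixture_def measure_pmf_bind
  by (subst measure_pmf.measure_bind[where N = "count_space UNIV"])
     (auto simp: measure_pmf_in_subprob_algebra)

definition projection :: "nat \<Rightarrow> bool list pmf \<Rightarrow> bool list pmf" where
  "projection k P = map_pmf (take k) P"

definition var_dist :: "nat \<Rightarrow> bool list pmf \<Rightarrow> bool list pmf \<Rightarrow> real" where
  "var_dist k P Q =
     2 * (SUP A \<in> Pow (words k). \<bar>measure_pmf.prob P A - measure_pmf.prob Q A\<bar>)"

end

theory Submission
  imports Defs
begin

text \<open>
  Consider the urn process with state \<open>(t, y)\<close> that emits 0 with probability
  \<open>(y - t) / (1 - t)\<close>, and after each letter replaces \<open>t\<close> by \<open>t / q\<close> and, if the letter
  was 1, also \<open>y\<close> by \<open>y / q\<close>. Started from \<open>(0, x)\<close> it produces $\nu^q_x$; started from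
  \<open>(q ^ n, q ^ J)\<close> it produces the $q$-exchangeable law on $\{0,1\}^n$ concentrated on the words
  with exactly \<open>J\<close> ones. Hence every $q$-exchangeable law is the mixture of the latter over its
  number of ones \<open>J\<close>, and \<open>\<mu>\<close> can be taken to be the law of \<open>q ^ J\<close>: the two processes with the
  same \<open>y\<close> differ in each step by \<open>t (1 - y) / (1 - t)\<close>, which is \<open>O(q ^ n)\<close> during the first
  \<open>k\<close> steps.
\<close>

section \<open>Words up to adjacent transpositions\<close>

abbreviation ones :: "bool list \<Rightarrow> nat" where
  "ones w \<equiv> count_list w True"

definition block_word :: "nat \<Rightarrow> nat \<Rightarrow> bool list" where
  "block_word j l = replicate j True @ replicate l False"

text \<open>Counts the pairs of a 0 standing before a 1, so it is the number of adjacent swaps that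
  sort the word into ones followed by zeros.\<close>

primrec inversions :: "bool list \<Rightarrow> nat" where
  "inversions [] = 0"
| "inversions (b # w) = inversions w + (if b then 0 else ones w)"

text \<open>Stated for arbitrary real functions, because inductions pass from \<open>f\<close> to
  \<open>\<lambda>w. f (b # w)\<close>, which is in general not normalized even if \<open>f\<close>
  is.\<close>

definition swap_covariant :: "real \<Rightarrow> nat \<Rightarrow> (bool list \<Rightarrow> real) \<Rightarrow> bool" where
  "swap_covariant q n f \<longleftrightarrow>
     (\<forall>w \<in> words n. \<forall>i. Suc i < n \<longrightarrow>
        f (swap_adj i w) = q powi (of_bool (w ! i) - of_bool (w ! Suc i)) * f w)"

lemma q_exchangeable_iff:
  "q_exchangeable q n P \<longleftrightarrow> set_pmf P \<subseteq> words n \<and> swap_covariant q n (pmf P)"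
  by (simp add: q_exchangeable_def swap_covariant_def)

lemma finite_words: "finite (words n)"
  using finite_lists_length_eq[of "UNIV :: bool set" n] by (simp add: words_def)

lemma words_Suc: "w \<in> words (Suc n) \<longleftrightarrow> (\<exists>b v. w = b # v \<and> v \<in> words n)"
  by (auto simp: words_def length_Suc_conv)

lemma swap_adj_0: "swap_adj 0 (a # b # w) = b # a # w"
  by (simp add: swap_adj_def)

lemma swap_adj_Suc: "swap_adj (Suc i) (a # w) = a # swap_adj i w"
  by (simp add: swap_adj_def)

lemma swap_covariant_Cons:
  assumes "swap_covariant q (Suc n) f"
  shows "swap_covariant q n (\<lambda>w. f (b # w))"
  unfolding swap_covariant_def
proof (intro ballI allI impI)
  fix w i assume "w \<in> words n" "Suc i < n"
  then have "f (swap_adj (Suc i) (b # w)) =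
      q powi (of_bool ((b # w) ! Suc i) - of_bool ((b # w) ! Suc (Suc i))) * f (b # w)"
    using assms by (simp add: swap_covariant_def words_def)
  then show "f (b # swap_adj i w) = q powi (of_bool (w ! i) - of_bool (w ! Suc i)) * f (b # w)"
    by (simp add: swap_adj_Suc)
qed

text \<open>The leading 0 moves to the right past \<open>j\<close> ones, and each exchange costs one
  factor \<open>q\<close>.\<close>

lemma swap_covariant_False_block:
  assumes "swap_covariant q (Suc (j + l)) f"
  shows "f (False # block_word j l) = q ^ j * f (block_word j (Suc l))"
  using assms
proof (induction j arbitrary: f)
  case 0
  then show ?case by (simp add: block_word_def)
next
  case (Suc j)
  let ?w = "True # False # block_word j l"
  have "?w \<in> words (Suc (Suc j + l))"
    by (simp add: words_def block_word_def)
  with Suc.prems have "f (swap_adj 0 ?w) = q * f ?w"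
    unfolding swap_covariant_def by fastforce
  moreover have "f ?w = q ^ j * f (True # block_word j (Suc l))"
    using Suc.IH[of "\<lambda>w. f (True # w)"] swap_covariant_Cons[of q "Suc (j + l)" f True] Suc.prems by simp
  ultimately show ?case
    by (simp add: swap_adj_0 block_word_def)
qed

lemma ones_le_length: "ones w \<le> length w"
  by (rule count_le_length)

text \<open>Sort the tail behind the fixed head, then move a leading 0 past the ones of the tail;
  the second cost is exactly the increment in \<open>inversions\<close>. Hence the values on the
  block words determine \<open>f\<close> on \<open>words n\<close>.\<close>

lemma swap_covariant_normal_form:
  assumes "swap_covariant q n f" and "w \<in> words n"
  shows "f w = q ^ inversions w * f (block_word (ones w) (n - ones w))"
  using assms
proof (induction n arbitrary: f w)
  case 0
  then show ?case by (simp add: words_def block_word_def)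
next
  case (Suc n)
  then obtain b v where w: "w = b # v" "v \<in> words n"
    by (auto simp: words_Suc)
  have le: "ones v \<le> n"
    using ones_le_length[of v] w by (simp add: words_def)
  have IH: "f (b # v) = q ^ inversions v * f (b # block_word (ones v) (n - ones v))"
    using Suc.IH[OF swap_covariant_Cons[OF Suc.prems(1), of b] w(2)] .
  show ?case
  proof (cases b)
    case True
    with IH w show ?thesis by (simp add: block_word_def)
  next
    case False
    have "f (False # block_word (ones v) (n - ones v)) =
        q ^ ones v * f (block_word (ones v) (Suc (n - ones v)))"
      using swap_covariant_False_block[of q "ones v" "n - ones v" f] Suc.prems(1) le by simp
    with False IH w le show ?thesis
      by (simp add: power_add Suc_diff_le)
  qed
qed

section \<open>The urn process\<close>

primrec urn :: "real \<Rightarrow> nat \<Rightarrow> real \<Rightarrow> real \<Rightarrow> bool list pmf" where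
  "urn q 0 t y = return_pmf []"
| "urn q (Suc m) t y = bind_pmf (bernoulli_pmf ((y - t) / (1 - t)))
     (\<lambda>b. if b then map_pmf (Cons False) (urn q m (t / q) y)
          else map_pmf (Cons True) (urn q m (t / q) (y / q)))"

text \<open>The product of the unclamped letter probabilities along the word. Its identities are
  pure algebra and need no condition on the state.\<close>

primrec urn_weight :: "real \<Rightarrow> bool list \<Rightarrow> real \<Rightarrow> real \<Rightarrow> real" where
  "urn_weight q [] t y = 1"
| "urn_weight q (b # w) t y =
     (if b then (1 - y) / (1 - t) * urn_weight q w (t / q) (y / q)
      else (y - t) / (1 - t) * urn_weight q w (t / q) y)"

text \<open>The states from which the first \<open>m\<close> letters have genuine probabilities: outside of them
  \<open>bernoulli_pmf\<close> clamps its parameter.\<close>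

definition urn_state :: "real \<Rightarrow> nat \<Rightarrow> real \<Rightarrow> real \<Rightarrow> bool" where
  "urn_state q m t y \<longleftrightarrow>
     t = 0 \<and> y \<in> Delta q \<or> (\<exists>n J. t = q ^ n \<and> y = q ^ J \<and> J \<le> n \<and> m \<le> n)"

lemma set_pmf_urn: "set_pmf (urn q m t y) \<subseteq> words m"
proof (induction m arbitrary: t y)
  case 0
  then show ?case by (simp add: words_def)
next
  case (Suc m)
  show ?case
    using Suc.IH[of "t / q" y] Suc.IH[of "t / q" "y / q"]
    by (auto simp: words_def subset_iff split: if_splits)
qed

text \<open>The transition rule does not involve the number of letters still to come, so cutting off
  the end of the word only stops the process earlier.\<close>

lemma map_take_urn:
  assumes "k \<le> m"
  shows "map_pmf (take k) (urn q m t y) = urn q k t y"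
  using assms
proof (induction k arbitrary: m t y)
  case 0
  then show ?case by (simp add: map_pmf_const)
next
  case (Suc k)
  then obtain m' where m: "m = Suc m'" "k \<le> m'"
    by (cases m) auto
  have *: "map_pmf (take (Suc k)) (map_pmf (Cons c) p) = map_pmf (Cons c) (map_pmf (take k) p)" for c :: bool and p
    by (simp add: pmf.map_comp o_def)
  show ?case
    unfolding m urn.simps map_bind_pmf
    by (intro bind_pmf_cong refl) (simp add: * Suc.IH m(2))
qed

lemma prob_bind_pmf:
  "measure_pmf.prob (bind_pmf M f) A = (\<integral>x. measure_pmf.prob (f x) A \<partial>measure_pmf M)"
  unfolding measure_pmf_bind
  by (subst measure_pmf.measure_bind[where N = "count_space UNIV"])
     (auto simp: measure_pmf_in_subprob_algebra)

section \<open>Urn laws: word probabilities, exchangeability and identification with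
  \<open>nu\<close>\<close>

context
  fixes q :: real
  assumes q_pos: "0 < q" and q_less_1: "q < 1"
begin

text \<open>A letter still to be emitted forces the exponent of \<open>t\<close> to be positive
  unless \<open>t = 0\<close>. So \<open>1 - t\<close> is at least \<open>1 - q\<close>, uniformly
  in the state.\<close>

lemma urn_state_bounds:
  assumes "urn_state q (Suc m) t y"
  shows "0 \<le> t" "t \<le> q" "t \<le> y" "y \<le> 1"
proof -
  have "t \<le> q \<and> 0 \<le> t \<and> t \<le> y \<and> y \<le> 1"
    using assms unfolding urn_state_def
  proof (elim disjE exE conjE)
    assume "t = 0" "y \<in> Delta q"
    then show ?thesis
      using q_pos q_less_1 by (auto simp: Delta_def intro: power_le_one)
  next
    fix n J assume *: "t = q ^ n" "y = q ^ J" "J \<le> n" "Suc m \<le> n"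
    have "q ^ n \<le> q ^ Suc 0" "q ^ n \<le> q ^ J" "q ^ J \<le> 1"
      using * q_pos q_less_1 by (auto intro: power_le_one simp del: power_Suc power_Suc0_right intro!: power_decreasing)
    with * q_pos show ?thesis by simp
  qed
  then show "0 \<le> t" "t \<le> q" "t \<le> y" "y \<le> 1" by auto
qed

lemma urn_state_prob:
  assumes "urn_state q (Suc m) t y"
  shows "0 \<le> (y - t) / (1 - t)" "(y - t) / (1 - t) \<le> 1"
    "1 - (y - t) / (1 - t) = (1 - y) / (1 - t)"
  using urn_state_bounds[OF assms] q_less_1 by (auto simp: field_simps)

text \<open>If \<open>y = t\<close>, the letter 0 has probability zero, and for \<open>t > 0\<close>
  the successor would violate \<open>J \<le> n\<close>. The condition \<open>y \<noteq> 1\<close>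
  for the letter 1 has the same purpose.\<close>

lemma urn_state_False:
  assumes "urn_state q (Suc m) t y" and "y \<noteq> t"
  shows "urn_state q m (t / q) y"
  using assms(1) unfolding urn_state_def
proof (elim disjE exE conjE)
  fix n J assume *: "t = q ^ n" "y = q ^ J" "J \<le> n" "Suc m \<le> n"
  with assms(2) have "J \<noteq> n" by auto
  with * obtain n' where n: "n = Suc n'" "J \<noteq> n"
    by (cases n) auto
  have "t / q = q ^ n'" "J \<le> n'" "m \<le> n'"
    using * n q_pos by auto
  with * show "t / q = 0 \<and> y \<in> Delta q \<or>
      (\<exists>n J. t / q = q ^ n \<and> y = q ^ J \<and> J \<le> n \<and> m \<le> n)"
    by blast
qed simp

lemma urn_state_True:
  assumes "urn_state q (Suc m) t y" and "y \<noteq> 1"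
  shows "urn_state q m (t / q) (y / q)"
  using assms(1) unfolding urn_state_def
proof (elim disjE exE conjE)
  assume *: "t = 0" "y \<in> Delta q"
  have "y / q \<in> Delta q"
  proof (cases "y = 0")
    case False
    with * obtain i where "y = q ^ i" by (auto simp: Delta_def)
    with assms(2) obtain i' where "y = q ^ Suc i'" by (cases i) auto
    with q_pos show ?thesis by (auto simp: Delta_def)
  qed (simp add: Delta_def)
  with * show "t / q = 0 \<and> y / q \<in> Delta q \<or>
      (\<exists>n J. t / q = q ^ n \<and> y / q = q ^ J \<and> J \<le> n \<and> m \<le> n)"
    by simp
next
  fix n J assume *: "t = q ^ n" "y = q ^ J" "J \<le> n" "Suc m \<le> n"
  with assms(2) obtain n' J' where "n = Suc n'" "J = Suc J'"
    by (cases n; cases J) auto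
  with * q_pos have "t / q = q ^ n'" "y / q = q ^ J'" "J' \<le> n'" "m \<le> n'"
    by auto
  then show "t / q = 0 \<and> y / q \<in> Delta q \<or>
      (\<exists>n J. t / q = q ^ n \<and> y / q = q ^ J \<and> J \<le> n \<and> m \<le> n)"
    by blast
qed

lemma pmf_urn:
  assumes "urn_state q m t y" and "w \<in> words m"
  shows "pmf (urn q m t y) w = urn_weight q w t y"
  using assms
proof (induction m arbitrary: t y w)
  case 0
  then show ?case by (simp add: words_def)
next
  case (Suc m)
  then obtain b v where w: "w = b # v" "v \<in> words m"
    by (auto simp: words_Suc)
  have Cons_same: "pmf (map_pmf (Cons c) p) (c # v) = pmf p v" for c :: bool and p
    by (rule pmf_map_inj') simp
  have Cons_other: "pmf (map_pmf (Cons (\<not> c)) p) (c # v) = 0" for c :: bool and p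
    by (auto simp: pmf_eq_0_set_pmf)
  note p = urn_state_prob[OF Suc.prems(1)]
  show ?case
  proof (cases b)
    case True
    have "pmf (urn q (Suc m) t y) w = (1 - y) / (1 - t) * pmf (urn q m (t / q) (y / q)) v"
      using p Cons_same[of True] Cons_other[of True] by (simp add: w True pmf_bind)
    also have "\<dots> = (1 - y) / (1 - t) * urn_weight q v (t / q) (y / q)"
      using Suc.IH[OF urn_state_True[OF Suc.prems(1)] w(2)] by (cases "y = 1") auto
    finally show ?thesis by (simp add: w True)
  next
    case False
    have "pmf (urn q (Suc m) t y) w = (y - t) / (1 - t) * pmf (urn q m (t / q) y) v"
      using p Cons_same[of False] Cons_other[of False] by (simp add: w False pmf_bind)
    also have "\<dots> = (y - t) / (1 - t) * urn_weight q v (t / q) y"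
      using Suc.IH[OF urn_state_False[OF Suc.prems(1)] w(2)] by (cases "y = t") auto
    finally show ?thesis by (simp add: w False)
  qed
qed

text \<open>Both orders lead to the same state \<open>(t / q / q, y / q)\<close> and have the same
  denominators; only the factor for the 0 changes, from \<open>y - t\<close> to
  \<open>(y - t) / q\<close>.\<close>

lemma urn_weight_swap_0:
  "urn_weight q (False # True # w) t y = q * urn_weight q (True # False # w) t y"
proof -
  have "(y - t) / (1 - t) * ((1 - y) / (1 - t / q) * W) =
      q * ((1 - y) / (1 - t) * ((y / q - t / q) / (1 - t / q) * W))" for W
    using q_pos by (simp add: diff_divide_distrib[symmetric] mult_ac)
  then show ?thesis by simp
qed

lemma urn_weight_swap_adj:
  assumes "Suc i < length w"
  shows "urn_weight q (swap_adj i w) t y =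
    q powi (of_bool (w ! i) - of_bool (w ! Suc i)) * urn_weight q w t y"
  using assms
proof (induction i arbitrary: w t y)
  case 0
  then obtain a b v where w: "w = a # b # v"
    by (cases w; cases "tl w") auto
  show ?case
    using q_pos by (cases a; cases b)
      (simp_all add: w swap_adj_0 urn_weight_swap_0 power_int_minus del: urn_weight.simps)
next
  case (Suc i)
  then obtain a v where w: "w = a # v" "Suc i < length v"
    by (cases w) auto
  show ?case
    using Suc.IH[OF w(2)] by (simp add: w swap_adj_Suc)
qed

lemma q_exchangeable_urn:
  assumes "urn_state q m t y"
  shows "q_exchangeable q m (urn q m t y)"
  unfolding q_exchangeable_iff swap_covariant_def
proof (intro conjI ballI allI impI)
  show "set_pmf (urn q m t y) \<subseteq> words m" by (rule set_pmf_urn)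
next
  fix w i assume w: "w \<in> words m" "Suc i < m"
  then have "swap_adj i w \<in> words m"
    by (simp add: words_def swap_adj_def)
  with w show "pmf (urn q m t y) (swap_adj i w) =
      q powi (of_bool (w ! i) - of_bool (w ! Suc i)) * pmf (urn q m t y) w"
    using urn_weight_swap_adj[of i w t y] by (simp add: pmf_urn[OF assms] words_def)
qed

text \<open>With \<open>t = 0\<close> the ones contribute the factors \<open>1 - x / q ^ i\<close>
  of the Pochhammer product, and each of the \<open>l\<close> zeros then contributes
  \<open>x / q ^ j\<close>.\<close>

lemma urn_weight_block_word:
  "urn_weight q (block_word j l) 0 x =
     q powi (- int (j * l)) * x ^ l * q_pochhammer x (inverse q) j"
proof (induction j arbitrary: x)
  case 0
  have "urn_weight q (replicate l False) 0 x = x ^ l"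
    by (induction l) auto
  then show ?case by (simp add: block_word_def q_pochhammer_def)
next
  case (Suc j)
  have "q_pochhammer x (inverse q) (Suc j) = (1 - x) * q_pochhammer (x / q) (inverse q) j"
    unfolding q_pochhammer_def prod.lessThan_Suc_shift by (simp add: field_simps)
  moreover have "q powi (- int (Suc j * l)) * x ^ l = q powi (- int (j * l)) * (x / q) ^ l"
  proof -
    have "q powi (- int (Suc j * l)) = inverse (q ^ (j * l)) * inverse (q ^ l)"
      by (simp only: power_int_minus power_int_of_nat mult_Suc power_add inverse_mult_distrib) (rule mult.commute)
    moreover have "q powi (- int (j * l)) = inverse (q ^ (j * l))"
      by (simp only: power_int_minus power_int_of_nat)
    ultimately show ?thesis by (simp add: divide_inverse power_mult_distrib power_inverse)
  qed
  moreover have "urn_weight q (block_word (Suc j) l) 0 x =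
      (1 - x) * urn_weight q (block_word j l) 0 (x / q)"
    by (simp add: block_word_def)
  ultimately show ?case
    using Suc.IH[of "x / q"] by simp
qed

text \<open>The urn law witnesses existence in the definite description. Uniqueness holds because
  the values on block words determine a \<open>q\<close>-exchangeable law.\<close>

lemma nu_eq_urn:
  assumes "x \<in> Delta q"
  shows "nu q m x = urn q m 0 x"
  unfolding nu_def
proof (rule the_equality, intro conjI allI impI)
  have state: "urn_state q m 0 x"
    using assms by (simp add: urn_state_def)
  then show ex: "q_exchangeable q m (urn q m 0 x)"
    by (rule q_exchangeable_urn)
  show blocks: "pmf (urn q m 0 x) (replicate j True @ replicate (m - j) False) =
      q powi (- int (j * (m - j))) * x ^ (m - j) * q_pochhammer x (inverse q) j" if "j \<le> m" for j
    using that pmf_urn[OF state, of "block_word j (m - j)"] urn_weight_block_word[of j "m - j" x]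
    by (simp add: words_def block_word_def)
  fix P
  assume P: "q_exchangeable q m P \<and>
     (\<forall>j\<le>m. pmf P (replicate j True @ replicate (m - j) False) =
        q powi (- int (j * (m - j))) * x ^ (m - j) * q_pochhammer x (inverse q) j)"
  show "P = urn q m 0 x"
  proof (rule pmf_eqI)
    fix w
    show "pmf P w = pmf (urn q m 0 x) w"
    proof (cases "w \<in> words m")
      case True
      then have "ones w \<le> m"
        using ones_le_length[of w] by (simp add: words_def)
      then have "pmf P (block_word (ones w) (m - ones w)) =
          pmf (urn q m 0 x) (block_word (ones w) (m - ones w))"
        using P blocks by (simp add: block_word_def)
      then show ?thesis
        using swap_covariant_normal_form[of q m "pmf P" w]
          swap_covariant_normal_form[of q m "pmf (urn q m 0 x)" w] P ex True
        by (simp add: q_exchangeable_iff)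
    next
      case False
      then show ?thesis
        using P ex by (metis pmf_eq_0_set_pmf q_exchangeable_iff subsetD)
    qed
  qed
qed

section \<open>Finite exchangeable laws as mixtures\<close>

text \<open>The exponents of \<open>t\<close> and \<open>y\<close> count the letters and the ones
  still to come: a 0 is impossible when they agree, a 1 when no ones remain.\<close>

lemma ones_urn:
  assumes "J \<le> n" and "w \<in> set_pmf (urn q n (q ^ n) (q ^ J))"
  shows "ones w = J"
  using assms
proof (induction n arbitrary: J w)
  case 0
  then show ?case by simp
next
  case (Suc n)
  have lt: "q ^ i < 1" if "i > 0" for i
    using that q_pos q_less_1 by (simp add: power_less_one_iff)
  have state: "urn_state q (Suc n) (q ^ Suc n) (q ^ J)"
    using Suc.prems(1) unfolding urn_state_def by blast
  let ?p = "(q ^ J - q ^ Suc n) / (1 - q ^ Suc n)"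
  have p: "0 \<le> ?p" "?p \<le> 1"
    using urn_state_prob[OF state] by auto
  from Suc.prems(2) obtain b where b: "b \<in> set_pmf (bernoulli_pmf ?p)"
    and w: "w \<in> set_pmf (if b then map_pmf (Cons False) (urn q n (q ^ Suc n / q) (q ^ J))
          else map_pmf (Cons True) (urn q n (q ^ Suc n / q) (q ^ J / q)))"
    by (auto simp del: power_Suc)
  have t: "q ^ Suc n / q = q ^ n"
    using q_pos by simp
  show ?case
  proof (cases b)
    case True
    with b p have "?p \<noteq> 0"
      by (auto simp: set_pmf_iff)
    then have "J \<noteq> Suc n" by auto
    with Suc.prems(1) have "J \<le> n" by simp
    moreover obtain v where "w = False # v" "v \<in> set_pmf (urn q n (q ^ n) (q ^ J))"
      using w True by (auto simp only: t if_True set_map_pmf)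
    ultimately show ?thesis using Suc.IH[of J v] by simp
  next
    case False
    with b p have "?p \<noteq> 1"
      by (auto simp: set_pmf_iff)
    then have "J \<noteq> 0"
      using lt[of "Suc n"] by (intro notI) (simp del: power_Suc)
    then obtain J' where J: "J = Suc J'" by (cases J) auto
    have y: "q ^ J / q = q ^ J'"
      using q_pos J by simp
    obtain v where "w = True # v" "v \<in> set_pmf (urn q n (q ^ n) (q ^ J'))"
      using w False by (auto simp only: t y if_False set_map_pmf)
    with Suc.IH[of J' v] Suc.prems(1) J show ?thesis by simp
  qed
qed

text \<open>On the words with \<open>J\<close> ones both \<open>P\<close> and the urn law are
  proportional to \<open>q ^ inversions w\<close>, and the urn law lives only there. So it is the
  conditional law of \<open>P\<close> given \<open>J\<close> ones whenever that event has positive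
  probability.\<close>

lemma q_exchangeable_eq_urn_mixture:
  assumes "q_exchangeable q n P"
  shows "P = bind_pmf P (\<lambda>w. urn q n (q ^ n) (q ^ ones w))"
proof (rule pmf_eqI)
  fix w
  let ?U = "\<lambda>J. urn q n (q ^ n) (q ^ J)"
  have sub: "set_pmf P \<subseteq> words n" and cov: "swap_covariant q n (pmf P)"
    using assms by (auto simp: q_exchangeable_iff)
  have ones_le: "ones v \<le> n" if "v \<in> words n" for v
    using that ones_le_length[of v] by (simp add: words_def)
  have pmf_U: "pmf (?U (ones v)) w = indicator {v. ones v = ones w} v * pmf (?U (ones w)) w"
    if "v \<in> words n" for v
    using ones_urn[OF ones_le[OF that], of w]
    by (cases "ones v = ones w") (auto simp: pmf_eq_0_set_pmf)
  have "pmf (bind_pmf P (\<lambda>w. ?U (ones w))) w =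
      measure_pmf.expectation P (\<lambda>v. pmf (?U (ones v)) w)"
    by (rule pmf_bind)
  also have "\<dots> = measure_pmf.expectation P
      (\<lambda>v. indicator {v. ones v = ones w} v * pmf (?U (ones w)) w)"
    using sub pmf_U by (intro integral_cong_AE) (auto simp: AE_measure_pmf_iff)
  also have "\<dots> = measure_pmf.prob P {v. ones v = ones w} * pmf (?U (ones w)) w"
    by simp
  finally have bind: "pmf (bind_pmf P (\<lambda>w. ?U (ones w))) w =
      measure_pmf.prob P {v. ones v = ones w} * pmf (?U (ones w)) w" .
  show "pmf P w = pmf (bind_pmf P (\<lambda>w. ?U (ones w))) w"
  proof (cases "w \<in> words n")
    case False
    then have "pmf P w = 0" "pmf (?U (ones w)) w = 0"
      using sub set_pmf_urn[of q n "q ^ n"] by (auto simp: pmf_eq_0_set_pmf)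
    then show ?thesis by (simp add: bind)
  next
    case True
    define J where "J = ones w"
    define s where "s = block_word J (n - J)"
    define A where "A = {v \<in> words n. ones v = J}"
    have "J \<le> n" using ones_le[OF True] by (simp add: J_def)
    then have covU: "swap_covariant q n (pmf (?U J))"
      using q_exchangeable_urn[of n "q ^ n" "q ^ J"]
      by (auto simp: q_exchangeable_iff urn_state_def)
    have P: "pmf P v = q ^ inversions v * pmf P s" if "v \<in> A" for v
      using that swap_covariant_normal_form[OF cov, of v] by (simp add: A_def s_def)
    have U: "pmf (?U J) v = q ^ inversions v * pmf (?U J) s" if "v \<in> A" for v
      using that swap_covariant_normal_form[OF covU, of v] by (simp add: A_def s_def)
    have fin: "finite A"
      using finite_words[of n] by (simp add: A_def)
    have "measure_pmf.prob P {v. ones v = J} = measure_pmf.prob P A"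
      using sub by (intro measure_pmf.finite_measure_eq_AE) (auto simp: AE_measure_pmf_iff A_def)
    also have "\<dots> = (\<Sum>v\<in>A. q ^ inversions v) * pmf P s"
      using fin P by (simp add: measure_measure_pmf_finite sum_distrib_right)
    finally have M: "measure_pmf.prob P {v. ones v = J} = (\<Sum>v\<in>A. q ^ inversions v) * pmf P s" .
    \<comment> \<open>The total mass of the urn law fixes the normalizing constant of the weights
      \<open>q ^ inversions v\<close>.\<close>
    have "set_pmf (?U J) \<subseteq> A"
      using ones_urn[OF \<open>J \<le> n\<close>] set_pmf_urn[of q n "q ^ n" "q ^ J"] by (auto simp: A_def)
    with fin have "(\<Sum>v\<in>A. pmf (?U J) v) = 1"
      by (rule sum_pmf_eq_1)
    then have one: "(\<Sum>v\<in>A. q ^ inversions v) * pmf (?U J) s = 1"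
      using U by (simp add: sum_distrib_right)
    have "w \<in> A" using True by (simp add: A_def J_def)
    \<comment> \<open>Exchanging the factors \<open>pmf P s\<close> and \<open>pmf (?U J) s\<close>
      avoids a division, so an event of probability zero needs no separate case.\<close>
    have "measure_pmf.prob P {v. ones v = J} * pmf (?U J) w =
        ((\<Sum>v\<in>A. q ^ inversions v) * pmf (?U J) s) * (q ^ inversions w * pmf P s)"
      unfolding M U[OF \<open>w \<in> A\<close>] by (simp only: mult_ac)
    also have "\<dots> = pmf P w"
      unfolding one P[OF \<open>w \<in> A\<close>] by simp
    finally show ?thesis by (simp add: bind J_def)
  qed
qed

section \<open>Comparison of the two processes\<close>

lemma prob_urn_Suc:
  assumes "0 \<le> (y - t) / (1 - t)" "(y - t) / (1 - t) \<le> 1"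
  shows "measure_pmf.prob (urn q (Suc m) t y) A =
    (y - t) / (1 - t) * measure_pmf.prob (urn q m (t / q) y) (Cons False -` A) +
    (1 - (y - t) / (1 - t)) * measure_pmf.prob (urn q m (t / q) (y / q)) (Cons True -` A)"
  unfolding urn.simps prob_bind_pmf using assms by simp

text \<open>Induction on the first letter: each step adds one discrepancy of letter probabilities.
  The bound has this form because \<open>q ^ n / q ^ m\<close> is unchanged when both exponents drop
  by one.\<close>

lemma abs_prob_urn_diff_le:
  assumes "J \<le> n" and "m \<le> n"
  shows "\<bar>measure_pmf.prob (urn q m (q ^ n) (q ^ J)) A - measure_pmf.prob (urn q m 0 (q ^ J)) A\<bar>
    \<le> real m * (q ^ n / (q ^ m * (1 - q)))"
  using assms
proof (induction m arbitrary: n J A)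
  case 0
  then show ?case by simp
next
  case (Suc m)
  then obtain n' where n: "n = Suc n'" "m \<le> n'" by (cases n) auto
  define t y p where "t = q ^ n" and "y = q ^ J" and "p = (y - t) / (1 - t)"
  define a where "a = measure_pmf.prob (urn q m (t / q) y) (Cons False -` A)"
  define a' where "a' = measure_pmf.prob (urn q m 0 y) (Cons False -` A)"
  define b where "b = measure_pmf.prob (urn q m (t / q) (y / q)) (Cons True -` A)"
  define b' where "b' = measure_pmf.prob (urn q m 0 (y / q)) (Cons True -` A)"
  define B where "B = real m * (q ^ n / (q ^ Suc m * (1 - q)))"
  have state: "urn_state q (Suc m) t y"
    using Suc.prems unfolding urn_state_def t_def y_def by blast
  note bounds = urn_state_bounds[OF state]
  have p: "0 \<le> p" "p \<le> 1" "1 - p = (1 - y) / (1 - t)"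
    using urn_state_prob[OF state] by (auto simp: p_def)
  have tq: "t / q = q ^ n'"
    using q_pos by (simp add: t_def n)
  have B: "real m * (q ^ n' / (q ^ m * (1 - q))) = B"
    using q_pos by (simp add: B_def n)
  have branch_False: "\<bar>p * (a - a')\<bar> \<le> p * B"
  \<comment> \<open>Here \<open>J\<close> may exceed \<open>n'\<close>, which puts the branch
    outside the induction hypothesis, but then its weight \<open>p\<close> is zero. The case
    \<open>J = 0\<close> of the other branch is similar.\<close>
  proof (cases "J = n")
    case True
    then have "p = 0" by (simp add: p_def y_def t_def)
    then show ?thesis by simp
  next
    case False
    then have "J \<le> n'" using Suc.prems n by simp
    from Suc.IH[OF this n(2), of "Cons False -` A"] have "\<bar>a - a'\<bar> \<le> B"
      unfolding B by (simp add: a_def a'_def tq y_def)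
    then show ?thesis
      using p(1,2) by (simp add: abs_mult mult_left_mono)
  qed
  have branch_True: "\<bar>(1 - p) * (b - b')\<bar> \<le> (1 - p) * B"
  proof (cases J)
    case 0
    then have "1 - p = 0" using p by (simp add: y_def)
    then show ?thesis by simp
  next
    case (Suc J')
    then have "J' \<le> n'" "y / q = q ^ J'"
      using Suc.prems n q_pos by (auto simp: y_def)
    with Suc.IH[OF _ n(2), of J' "Cons True -` A"] have "\<bar>b - b'\<bar> \<le> B"
      unfolding B by (simp add: b_def b'_def tq)
    then show ?thesis
      using p(1,2) by (simp add: abs_mult mult_left_mono)
  qed
  have step: "\<bar>(p - y) * (a' - b')\<bar> \<le> q ^ n / (q ^ Suc m * (1 - q))"
  proof -
    have "p - y = - (t * (1 - y) / (1 - t))"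
      using bounds q_less_1 by (simp add: p_def field_simps)
    then have "\<bar>p - y\<bar> = t * (1 - y) / (1 - t)"
      using bounds q_less_1 by simp
    also have "\<dots> \<le> t * 1 / (1 - q)"
      using bounds q_pos q_less_1 by (intro frac_le mult_left_mono) auto
    \<comment> \<open>Weakened on purpose, so that this error equals one of the \<open>m\<close>
      equal summands of \<open>B\<close>.\<close>
    also have "\<dots> \<le> t / (q ^ Suc m * (1 - q))"
      using bounds q_pos q_less_1
      by (auto intro!: divide_left_mono mult_left_le_one_le power_le_one simp del: power_Suc)
    finally have 1: "\<bar>p - y\<bar> \<le> q ^ n / (q ^ Suc m * (1 - q))" by (simp add: t_def)
    have "\<bar>a' - b'\<bar> \<le> 1"
      unfolding a'_def b'_def abs_le_iff
      using measure_pmf.prob_le_1[of _ "Cons False -` A"] measure_pmf.prob_le_1[of _ "Cons True -` A"]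
      by (simp add: add_increasing2 le_diff_eq diff_le_eq)
    then have "\<bar>p - y\<bar> * \<bar>a' - b'\<bar> \<le> \<bar>p - y\<bar>"
      by (simp add: mult_left_le)
    with 1 show ?thesis by (simp add: abs_mult)
  qed
  have "measure_pmf.prob (urn q (Suc m) t y) A - measure_pmf.prob (urn q (Suc m) 0 y) A =
      p * a + (1 - p) * b - (y * a' + (1 - y) * b')"
    using prob_urn_Suc[of y t m A] prob_urn_Suc[of y 0 m A] p bounds
    by (simp add: p_def a_def a'_def b_def b'_def del: urn.simps)
  \<comment> \<open>Separates the later errors, averaged with weights \<open>p\<close> and
    \<open>1 - p\<close>, from the error in the first letter.\<close>
  also have "\<dots> = p * (a - a') + (1 - p) * (b - b') + (p - y) * (a' - b')"
    by (simp add: algebra_simps)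
  finally have "\<bar>measure_pmf.prob (urn q (Suc m) t y) A - measure_pmf.prob (urn q (Suc m) 0 y) A\<bar>
      \<le> p * B + (1 - p) * B + q ^ n / (q ^ Suc m * (1 - q))"
    using branch_False branch_True step by linarith
  also have "\<dots> = real (Suc m) * (q ^ n / (q ^ Suc m * (1 - q)))"
    unfolding B_def of_nat_Suc by (simp only: distrib_right left_diff_distrib)
  finally show ?case by (simp only: t_def y_def)
qed

end

section \<open>Averaging the comparison over the number of ones\<close>

lemma abs_prob_bind_diff_le:
  assumes "\<And>x. x \<in> set_pmf M \<Longrightarrow> \<bar>measure_pmf.prob (f x) A - measure_pmf.prob (g x) A\<bar> \<le> C"
  shows "\<bar>measure_pmf.prob (bind_pmf M f) A - measure_pmf.prob (bind_pmf M g) A\<bar> \<le> C"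
proof -
  have int: "integrable (measure_pmf M) (\<lambda>x. measure_pmf.prob (h x) A)" for h :: "_ \<Rightarrow> 'b pmf"
    by (rule measure_pmf.integrable_const_bound[where B = 1]) auto
  let ?d = "\<lambda>x. measure_pmf.prob (f x) A - measure_pmf.prob (g x) A"
  have "measure_pmf.prob (bind_pmf M f) A - measure_pmf.prob (bind_pmf M g) A =
      measure_pmf.expectation M ?d"
    by (simp add: prob_bind_pmf int)
  also have "\<bar>\<dots>\<bar> \<le> measure_pmf.expectation M (\<lambda>x. \<bar>?d x\<bar>)"
    by (rule integral_abs_bound)
  also have "\<dots> \<le> measure_pmf.expectation M (\<lambda>x. C)"
    using assms int by (intro integral_mono_AE) (auto simp: AE_measure_pmf_iff)
  finally show ?thesis by simp
qed

lemma var_dist_le: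
  assumes "\<And>A. \<bar>measure_pmf.prob P A - measure_pmf.prob Q A\<bar> \<le> C"
  shows "var_dist k P Q \<le> 2 * C"
  unfolding var_dist_def using assms by (intro mult_left_mono cSUP_least) auto

theorem theorem3p1p1:
  fixes q :: real
  assumes "0 < q" and "q < 1"
  shows "\<exists>c :: nat \<Rightarrow> real. \<forall>n\<ge>1. \<forall>P. q_exchangeable q n P \<longrightarrow>
           (\<exists>\<mu> :: real pmf. set_pmf \<mu> \<subseteq> Delta q \<and>
              (\<forall>k\<in>{1..n}. var_dist k (projection k P) (mixture q \<mu> k) \<le> c k * q ^ n))"
\<comment> \<open>The 2 comes from the normalization of the variational distance, the rest from
  comparing \<open>k\<close> steps of the two urns.\<close>
proof (rule exI[of _ "\<lambda>k. 2 * real k / (q ^ k * (1 - q))"], intro allI impI)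
  fix n P assume ex: "q_exchangeable q n P"
  \<comment> \<open>Chosen before \<open>k\<close>, so one measure serves all \<open>k\<close>. It
    gives both laws the same mixing variable, the number of ones under \<open>P\<close>.\<close>
  define \<mu> where "\<mu> = map_pmf (\<lambda>w. q ^ ones w) P"
  have Delta: "set_pmf \<mu> \<subseteq> Delta q"
    by (auto simp: \<mu>_def Delta_def)
  have "var_dist k (projection k P) (mixture q \<mu> k) \<le> 2 * real k / (q ^ k * (1 - q)) * q ^ n"
    if k: "k \<in> {1..n}" for k
  proof -
    have "projection k P =
        map_pmf (take k) (bind_pmf P (\<lambda>w. urn q n (q ^ n) (q ^ ones w)))"
      using q_exchangeable_eq_urn_mixture[OF assms ex] by (simp add: projection_def)
    also have "\<dots> = bind_pmf P (\<lambda>w. urn q k (q ^ n) (q ^ ones w))"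
      using k by (simp add: map_bind_pmf map_take_urn)
    finally have proj: "projection k P = bind_pmf P (\<lambda>w. urn q k (q ^ n) (q ^ ones w))" .
    have mix: "mixture q \<mu> k = bind_pmf P (\<lambda>w. urn q k 0 (q ^ ones w))"
      by (simp add: mixture_def \<mu>_def bind_map_pmf nu_eq_urn[OF assms] Delta_def)
    have "ones w \<le> n" if "w \<in> set_pmf P" for w
      using that ex ones_le_length[of w] by (auto simp: q_exchangeable_iff words_def)
    then have "var_dist k (projection k P) (mixture q \<mu> k) \<le>
        2 * (real k * (q ^ n / (q ^ k * (1 - q))))"
      unfolding proj mix using k
      by (intro var_dist_le abs_prob_bind_diff_le abs_prob_urn_diff_le[OF assms]) auto
    then show ?thesis by simp
  qed
  with Delta show "\<exists>\<mu> :: real pmf. set_pmf \<mu> \<subseteq> Delta q \<and>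
      (\<forall>k\<in>{1..n}. var_dist k (projection k P) (mixture q \<mu> k) \<le>
         (2 * real k / (q ^ k * (1 - q))) * q ^ n)"
    by blast
qed

end
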